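(* Let $m\ge1$, $a_1,\ldots,a_m\in\mathbb Z$ and $b_1,\ldots,b_m\in\mathbb N$. Let $f:\mathbb N\to\mathbb Z$ satisfy $k\mid f(k)$ for all $k\in\mathbb N$, and set $\bar f(k)=f(k+1)-(-1)^mf(k)$. Let $n$ be a positive integer and $d=\gcd(a_1,\ldots,a_m,b_1,\ldots,b_m,n)$. Then $$\sum_{k=0}^{n-1}\bar f(k)\prod_{i=1}^m\binom{a_i-1}{b_i+k}\equiv0\pmod{d}.$$ If moreover $k^2\mid f(k)$ for all $k\in\mathbb N$, then $$\sum_{k=0}^{n-1}\bar f(k)\prod_{i=1}^m\binom{a_i-1}{b_i+k}\equiv(-1)^m\Big(\sum_{i=1}^ma_i\Big)\sum_{0<k<n}\frac{f(k)}k\prod_{i=1}^m\binom{a_i-1}{b_i+k}\pmod {d^2}.$$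
   Context: For an integer $x$ and $k\in\mathbb N$, $\binom xk=x(x-1)\cdots(x-k+1)/k!$. *)

theory Defs
  imports Complex_Main "HOL-Number_Theory.Cong"
begin

text \<open>
  The library's \<^const>\<open>gbinomial\<close> contains this integer function as an instance, but in most theories
  its syntactic type is restricted to fields of characteristic 0.
  The lemma \<open>of_int_ibinom\<close> connects the two. Since \<open>k!\<close> divides every product of \<open>k\<close> consecutive
  integers (lemma \<open>fact_mult_ibinom\<close>), the integer division is exact.
\<close>

definition ibinom :: "int \<Rightarrow> nat \<Rightarrow> int" where
  "ibinom x k = (\<Prod>i = 0..<k. x - int i) div fact k"

lemma fact_mult_ibinom: "fact k * ibinom x k = (\<Prod>i = 0..<k. x - int i)"
  using gbinomial_int_mult_fact[of k x] by (simp add: ibinom_def gbinomial_prod_rev)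

lemma of_int_ibinom: "of_int (ibinom x k) = (of_int x :: 'a::field_char_0) gchoose k"
  using of_int_gbinomial[of x k, where 'a = 'a] by (simp add: ibinom_def gbinomial_prod_rev)

end

theory Submission
  imports Defs
begin

text \<open>
  Summation by parts (with \<open>f 0 = 0\<close> and \<open>d dvd n\<close>) reduces the claim to \<open>f k (P (k-1) - (-1)^m P k)\<close> for
  \<open>0 < k < n\<close>, where \<open>P k\<close> is the product of binomial coefficients. Write \<open>x\<close>, \<open>y\<close> for the factors of
  \<open>P (k-1)\<close>, \<open>P k\<close> with index \<open>i\<close>. The absorption identity \<open>(b + k) (x + y) = a x\<close> gives
  \<open>k x \<equiv> - k y\<close> modulo \<open>d\<close> and, applied twice, \<open>k\<^sup>2 x \<equiv> - k\<^sup>2 y - k a y\<close> modulo \<open>d\<^sup>2\<close>.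
  Replacing the factors \<open>x\<close> by \<open>-y\<close> one at a time yields both congruences.
\<close>

text \<open>Peeling the last factor off the falling product of length \<open>Suc j\<close> and
  cancelling \<open>fact j\<close> gives the ratio of neighbouring binomials. With
  \<open>x = a - 1\<close> the right-hand side becomes a multiple of \<open>a\<close>.\<close>

lemma ibinom_absorb:
  "int (Suc j) * (ibinom x j + ibinom x (Suc j)) = (x + 1) * ibinom x j"
proof -
  have "fact j * (int (Suc j) * ibinom x (Suc j)) = fact j * ((x - int j) * ibinom x j)"
    using fact_mult_ibinom[of "Suc j" x]
    by (simp add: fact_mult_ibinom[of j x, symmetric] algebra_simps)
  then have "int (Suc j) * ibinom x (Suc j) = (x - int j) * ibinom x j"
    by simp
  then show ?thesis
    by (simp add: algebra_simps)
qed

text \<open>Each inner \<open>f k\<close> occurs twice, once with weight \<open>P (k - 1)\<close>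
  and once with \<open>- c * P k\<close>. Only the top boundary term survives, since the bottom one
  carries \<open>f 0\<close>.\<close>

lemma sum_shift_diff:
  fixes f P :: "nat \<Rightarrow> 'a::comm_ring_1"
  assumes "f 0 = 0"
  shows "(\<Sum>k = 0..<Suc n. (f (k + 1) - c * f k) * P k)
    = f (Suc n) * P n + (\<Sum>k\<in>{0<..<Suc n}. f k * (P (k - 1) - c * P k))"
proof (induction n)
  case 0
  have "{0<..<Suc 0} = {}"
    by auto
  then show ?case
    using assms by simp
next
  case (Suc n)
  have "{0<..<Suc (Suc n)} = insert (Suc n) {0<..<Suc n}"
    by auto
  with Suc show ?case
    by (simp add: algebra_simps)
qed

text \<open>\<open>k\<close> need not be invertible modulo \<open>d\<close>, so it cannot be
  cancelled; a single copy of it is passed from factor to factor and pays for every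
  exchange.\<close>

lemma cong_mult_prod:
  fixes k d :: int
  assumes "finite I" and "\<And>i. i \<in> I \<Longrightarrow> [k * x i = k * z i] (mod d)"
  shows "[k * prod x I = k * prod z I] (mod d)"
  using assms
proof (induction I rule: finite_induct)
  case empty
  show ?case by simp
next
  case (insert i I)
  have "[k * x i * prod x I = k * z i * prod x I] (mod d)"
    using insert by (intro cong_scalar_right) auto
  also have "k * z i * prod x I = z i * (k * prod x I)"
    by simp
  also have "[z i * (k * prod x I) = z i * (k * prod z I)] (mod d)"
    using insert by (intro cong_scalar_left[of _ _ _ "z i"] insert.IH) auto
  finally show ?case
    using insert.hyps by (simp add: mult_ac)
qed

text \<open>The multiplier \<open>a\<close> contributes a second factor \<open>d\<close>, which
  lifts the congruence from \<open>d\<close> to the square of \<open>d\<close>.\<close>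

lemma cong_mult_square:
  fixes k d a :: int
  assumes "[k * x = k * z] (mod d)" and "d dvd a"
  shows "[k * a * x = k * a * z] (mod d\<^sup>2)"
proof -
  have "d * d dvd a * (k * x - k * z)"
    using assms by (intro mult_dvd_mono) (simp_all add: cong_iff_dvd_diff)
  then show ?thesis
    by (simp add: cong_iff_dvd_diff power2_eq_square algebra_simps)
qed

text \<open>Each exchange of a factor costs a first-order correction with coefficient
  \<open>k * a i\<close>, and these corrections add up to \<open>k * sum a I\<close>.\<close>

lemma cong_square_mult_prod:
  fixes k d :: int
  assumes "finite I" and "\<And>i. i \<in> I \<Longrightarrow> [k * x i = k * z i] (mod d)"
    and "\<And>i. i \<in> I \<Longrightarrow> d dvd a i"
    and "\<And>i. i \<in> I \<Longrightarrow> [k\<^sup>2 * x i = k\<^sup>2 * z i + k * a i * z i] (mod d\<^sup>2)"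
  shows "[k\<^sup>2 * prod x I = k\<^sup>2 * prod z I + k * sum a I * prod z I] (mod d\<^sup>2)"
  using assms
proof (induction I rule: finite_induct)
  case empty
  show ?case by simp
next
  case (insert i I)
  have "[x i * (k\<^sup>2 * prod x I) = x i * (k\<^sup>2 * prod z I + k * sum a I * prod z I)] (mod d\<^sup>2)"
    using insert by (intro cong_scalar_left) auto
  also have "x i * (k\<^sup>2 * prod z I + k * sum a I * prod z I)
      = prod z I * (k\<^sup>2 * x i + k * sum a I * x i)"
    by (simp add: algebra_simps)
  \<comment> \<open>The main term uses the hypothesis modulo the square. In the correction term
    \<open>d\<close> divides \<open>sum a I\<close>, so \<open>x i\<close> may be exchanged by
    \<open>cong_mult_square\<close>.\<close>
  also have "[prod z I * (k\<^sup>2 * x i + k * sum a I * x i)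
      = prod z I * ((k\<^sup>2 * z i + k * a i * z i) + k * sum a I * z i)] (mod d\<^sup>2)"
    using insert.prems
    by (intro cong_scalar_left[of _ _ _ "prod z I"] cong_add cong_mult_square dvd_sum) auto
  also have "prod z I * ((k\<^sup>2 * z i + k * a i * z i) + k * sum a I * z i)
      = k\<^sup>2 * (z i * prod z I) + k * (a i + sum a I) * (z i * prod z I)"
    by (simp add: algebra_simps)
  finally show ?case
    using insert.hyps by (simp add: mult_ac)
qed

lemma ibinom_pred_cong:
  assumes "d dvd a" and "d dvd int b" and "k > 0"
  shows "[int k * ibinom (a - 1) (b + (k - 1)) = int k * - ibinom (a - 1) (b + k)] (mod d)" (is ?thesis1)
    and "[(int k)\<^sup>2 * ibinom (a - 1) (b + (k - 1))
      = (int k)\<^sup>2 * - ibinom (a - 1) (b + k) + int k * a * - ibinom (a - 1) (b + k)] (mod d\<^sup>2)" (is ?thesis2)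
proof -
  define x y where "x = ibinom (a - 1) (b + (k - 1))" and "y = ibinom (a - 1) (b + k)"
  have "int (b + k) * (x + y) = a * x"
    using ibinom_absorb[of "b + (k - 1)" "a - 1"] \<open>k > 0\<close> by (simp add: x_def y_def)
  then have eq: "int k * (x + y) = a * x - int b * (x + y)"
    by (simp add: algebra_simps)
  have dvd: "d dvd int k * (x + y)"
    unfolding eq using assms by simp
  then show ?thesis1
    unfolding x_def[symmetric] y_def[symmetric] by (simp add: cong_iff_dvd_diff algebra_simps)
  have "(int k)\<^sup>2 * (x + y) = int k * (int k * (x + y))"
    by (simp add: power2_eq_square)
  also have "\<dots> = int k * (a * x - int b * (x + y))"
    by (simp only: eq)
  \<comment> \<open>Adding \<open>int k * a * y\<close> turns \<open>a * x\<close> into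
    \<open>a * (x + y)\<close>, so the discrepancy splits into two factors, each divisible by
    \<open>d\<close>.\<close>
  finally have "(int k)\<^sup>2 * x - ((int k)\<^sup>2 * - y + int k * a * - y) = (a - int b) * (int k * (x + y))"
    by (simp add: algebra_simps)
  moreover have "d * d dvd (a - int b) * (int k * (x + y))"
    using assms dvd by (intro mult_dvd_mono) auto
  ultimately show ?thesis2
    unfolding x_def[symmetric] y_def[symmetric] by (simp only: cong_iff_dvd_diff power2_eq_square)
qed

theorem theorem4p1:
  fixes m n :: nat and a :: "nat \<Rightarrow> int" and b :: "nat \<Rightarrow> nat"
    and f fbar :: "nat \<Rightarrow> int" and d :: int
  assumes "m \<ge> 1"
    and "n > 0"
    and "\<And>k. int k dvd f k"
    and "\<And>k. fbar k = f (k + 1) - (-1) ^ m * f k"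
    and "d = Gcd (a ` {1..m} \<union> (\<lambda>i. int (b i)) ` {1..m} \<union> {int n})"
  shows "[(\<Sum>k = 0..<n. fbar k * (\<Prod>i = 1..m. ibinom (a i - 1) (b i + k))) = 0] (mod d)
    \<and> ((\<forall>k. (int k)\<^sup>2 dvd f k) \<longrightarrow>
        [(\<Sum>k = 0..<n. fbar k * (\<Prod>i = 1..m. ibinom (a i - 1) (b i + k)))
          = (-1) ^ m * (\<Sum>i = 1..m. a i)
            * (\<Sum>k \<in> {0<..<n}. (f k div int k) * (\<Prod>i = 1..m. ibinom (a i - 1) (b i + k)))]
        (mod d\<^sup>2))"
proof -
  define P where "P k = (\<Prod>i = 1..m. ibinom (a i - 1) (b i + k))" for k
  define S where "S = (\<Sum>k = 0..<n. fbar k * P k)"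
  have da: "d dvd a i" and db: "d dvd int (b i)" if "i \<in> {1..m}" for i
    unfolding assms(5) using that by (blast intro: Gcd_dvd)+
  have dn: "d dvd int n"
    unfolding assms(5) by (blast intro: Gcd_dvd)
  \<comment> \<open>The sign in the theorem comes from the \<open>m\<close> replacements of a factor
    by the negative of its neighbour.\<close>
  have prod_neg: "(\<Prod>i = 1..m. - ibinom (a i - 1) (b i + k)) = (-1) ^ m * P k" for k
    by (simp add: P_def prod_uminus)
  have kP: "[int k * P (k - 1) = int k * ((-1) ^ m * P k)] (mod d)" if "k > 0" for k
    unfolding prod_neg[symmetric] unfolding P_def
    by (intro cong_mult_prod ibinom_pred_cong(1) da db that) auto
  have k2P: "[(int k)\<^sup>2 * P (k - 1)
      = (int k)\<^sup>2 * ((-1) ^ m * P k) + int k * (\<Sum>i = 1..m. a i) * ((-1) ^ m * P k)] (mod d\<^sup>2)"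
    if "k > 0" for k
    unfolding prod_neg[symmetric] unfolding P_def
    by (intro cong_square_mult_prod ibinom_pred_cong da db that) auto
  have "f 0 = 0"
    using assms(3)[of 0] by simp
  from sum_shift_diff[of f, OF this, where n = "n - 1" and c = "(-1) ^ m" and P = P]
  have S: "S = f n * P (n - 1) + (\<Sum>k\<in>{0<..<n}. f k * (P (k - 1) - (-1) ^ m * P k))"
    using assms(2) by (simp add: S_def assms(4))
  have "d dvd f k * (P (k - 1) - (-1) ^ m * P k)" if "k \<in> {0<..<n}" for k
  proof -
    \<comment> \<open>The multiplier \<open>int k\<close> required by \<open>kP\<close> is supplied
      by \<open>f k\<close>.\<close>
    have "d dvd int k * (P (k - 1) - (-1) ^ m * P k)"
      using kP[of k] that by (simp add: cong_iff_dvd_diff right_diff_distrib)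
    also have "\<dots> dvd f k * (P (k - 1) - (-1) ^ m * P k)"
      using assms(3) by (intro mult_dvd_mono) auto
    finally show ?thesis .
  qed
  moreover have "d dvd f n"
    using dn assms(3) dvd_trans by blast
  ultimately have 1: "[S = 0] (mod d)"
    unfolding S cong_0_iff by (intro dvd_add dvd_sum) auto
  have 2: "[S = (-1) ^ m * (\<Sum>i = 1..m. a i) * (\<Sum>k\<in>{0<..<n}. (f k div int k) * P k)] (mod d\<^sup>2)"
    if f2: "\<forall>k. (int k)\<^sup>2 dvd f k"
  proof -
    have "d\<^sup>2 dvd f n"
      using dn f2 dvd_power_same dvd_trans by blast
    then have "[f n * P (n - 1) = 0] (mod d\<^sup>2)"
      by (simp add: cong_0_iff)
    moreover have "[f k * (P (k - 1) - (-1) ^ m * P k)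
        = (-1) ^ m * (\<Sum>i = 1..m. a i) * ((f k div int k) * P k)] (mod d\<^sup>2)"
      if "k \<in> {0<..<n}" for k
    proof -
      from f2 obtain g where g: "f k = (int k)\<^sup>2 * g"
        by (meson dvdE)
      \<comment> \<open>The division is exact as \<open>k > 0\<close>. The quotient
        \<open>int k * g\<close> is what \<open>g\<close> times the correction term of
        \<open>k2P\<close> contains, which produces the right-hand side.\<close>
      have "f k div int k = int k * g"
        using that by (simp add: g power2_eq_square)
      moreover have "d\<^sup>2 dvd g * ((int k)\<^sup>2 * P (k - 1)
          - ((int k)\<^sup>2 * ((-1) ^ m * P k) + int k * (\<Sum>i = 1..m. a i) * ((-1) ^ m * P k)))"
        using k2P[of k] that by (simp add: cong_iff_dvd_diff)
      ultimately show ?thesis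
        by (simp add: cong_iff_dvd_diff g algebra_simps)
    qed
    ultimately have "[S = 0 + (\<Sum>k\<in>{0<..<n}. (-1) ^ m * (\<Sum>i = 1..m. a i) * ((f k div int k) * P k))] (mod d\<^sup>2)"
      unfolding S by (intro cong_add cong_sum) auto
    then show ?thesis
      by (simp add: sum_distrib_left)
  qed
  from 1 2 show ?thesis
    unfolding S_def P_def by blast
qed

end
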